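(* Let $G$ be a connected graph of order $n \ge 3$ with minimum degree $\delta \ge 2$. Then \[ \gamma_{\rm it}^{\rm g\prime}(G) \le \left( \frac{2\delta-1}{3\delta-2} \right) n - \frac{(\delta - 1)(2\delta - 3)}{3\delta-2}, \] where $\gamma_{\rm it}^{\rm g\prime}(G)$ is the Staller-start game total isolation number of $G$.
   Context: All graphs are finite and simple. For a vertex set $S$, $N_G(S)$ denotes the set of vertices adjacent to at least one vertex of $S$, and $G - X$ is the graph obtained by deleting the vertices of $X$. The total isolation game on a graph $G$ is played by two players, Dominator and Staller, who alternately select vertices of $G$. If $S$ is the set of vertices selected so far, a vertex $v$ may be selected only if $v$ is adjacent to some vertex $u$ such that either $u$ belongs to a component of $G - N_G(S)$ of order at least $2$, or $u \in S$ and $u$ is an isolated vertex of $G - N_G(S)$. The game ends when no such vertex exists. Dominator aims to minimize the total number of selected vertices, Staller aims to maximize it. The Staller-start game total isolation number $\gamma_{\rm it}^{\rm g\prime}(G)$ is the number of moves in the game in which Staller makes the first move and both players play optimally. *)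

theory Defs
  imports Complex_Main "Graph_Theory.Digraph_Component"
begin

text \<open>
  A finite simple graph is an instance of the locale \<^locale>\<open>graph\<close>: a finite symmetric digraph
  without loops or parallel arcs, each edge being a pair of opposite arcs. Hence
  \<^const>\<open>out_degree\<close> is the vertex degree, and the strongly connected components
  (\<^const>\<open>pre_digraph.sccs\<close>) are the ordinary connected components.
\<close>

definition min_degree :: "('a, 'b) pre_digraph \<Rightarrow> nat" where
  "min_degree G = (MIN v \<in> verts G. out_degree G v)"

context pre_digraph
begin

definition neighborhood :: "'a set \<Rightarrow> 'a set" where
  "neighborhood S = {v \<in> verts G. \<exists>s\<in>S. v \<rightarrow>\<^bsub>G\<^esub> s}"

definition residual :: "'a set \<Rightarrow> ('a, 'b) pre_digraph" where
  "residual S = G \<restriction> (verts G - neighborhood S)"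

definition playable :: "'a set \<Rightarrow> 'a set" where
  "playable S = {v \<in> verts G. \<exists>u. v \<rightarrow>\<^bsub>G\<^esub> u \<and>
     ((\<exists>C \<in> pre_digraph.sccs (residual S). u \<in> verts C \<and> card (verts C) \<ge> 2) \<or>
      (u \<in> S \<and> u \<in> verts (residual S) \<and> out_degree (residual S) u = 0))}"

end

text \<open>No vertex is played twice: a neighbour of a played vertex is not in the residual graph.\<close>

lemma (in graph) playable_fresh:
  assumes "v \<in> playable S"
  shows "v \<in> verts G - S"
proof -
  from assms obtain u where v: "v \<in> verts G" and adj: "v \<rightarrow>\<^bsub>G\<^esub> u"
    and u: "(\<exists>C \<in> pre_digraph.sccs (residual S). u \<in> verts C) \<or> u \<in> verts (residual S)"
    unfolding playable_def by blast
  from u have "u \<in> verts (residual S)"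
    by (auto dest!: pre_digraph.in_sccs_imp_induced induced_imp_subgraph subgraph_imp_subverts)
  then have "u \<in> verts G" "u \<notin> neighborhood S"
    by (auto simp: residual_def)
  moreover have "u \<rightarrow>\<^bsub>G\<^esub> v"
    using adj by (rule graph_symmetric)
  ultimately have "v \<notin> S"
    by (auto simp: neighborhood_def)
  with v show ?thesis by blast
qed

datatype player = Dominator | Staller

context graph
begin

text \<open>
  \<open>remaining_moves p S\<close> is the minimax value of the position in which \<open>S\<close> has been played and
  \<open>p\<close> is to move: the number of further moves under optimal play.
\<close>

function remaining_moves :: "player \<Rightarrow> 'a set \<Rightarrow> nat" where
  "remaining_moves Dominator S =
     (if playable S = {} then 0
      else Suc (MIN v \<in> playable S. remaining_moves Staller (insert v S)))"
| "remaining_moves Staller S =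
     (if playable S = {} then 0
      else Suc (MAX v \<in> playable S. remaining_moves Dominator (insert v S)))"
  by pat_completeness auto

termination
proof (relation "measure (\<lambda>(p, S). card (verts G - S))")
  have less: "card (verts G - insert v S) < card (verts G - S)" if "v \<in> playable S" for v S
    using playable_fresh[OF that] by (intro psubset_card_mono) auto
  show "((Staller, insert v S), (Dominator, S)) \<in> measure (\<lambda>(p, S). card (verts G - S))"
    if "v \<in> playable S" for v S
    using less[OF that] by simp
  show "((Dominator, insert v S), (Staller, S)) \<in> measure (\<lambda>(p, S). card (verts G - S))"
    if "v \<in> playable S" for v S
    using less[OF that] by simp
qed simp

declare remaining_moves.simps [simp del]

definition staller_start_game_total_isolation_number :: nat where
  "staller_start_game_total_isolation_number = remaining_moves Staller {}"

end

end

theory Submission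
  imports Defs
begin

text \<open>
  Call an undominated vertex active if it has an undominated neighbour, a played vertex pending
  if it is undominated, and a dominated vertex live if it has an active neighbour. With weight
  \<open>2\<delta> - 1\<close> on active, \<open>3\<delta> - 2\<close> on pending and \<open>1\<close> on live vertices, let \<open>\<Phi>\<close> be the total weight.
  Then \<open>(3\<delta> - 2)\<close> times the number of remaining moves is at most \<open>\<Phi>\<close> when Dominator is to move
  and at most \<open>\<Phi> + \<delta> - 1\<close> when Staller is to move. If a pending vertex has a live neighbour,
  Dominator plays that neighbour and gains an extra \<open>\<delta>\<close>; this compensates for the weak replies of
  Staller, and after the first move it pays for the live neighbours of the first vertex.
  In all other positions Dominator plays a vertex with many active neighbours, and when there is none the
  active vertices induce paths and cycles, where a vertex close to a leaf or a vertex of a cycle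
  is good enough. Only for \<open>\<delta> = 2\<close> can such a move on a cycle fall short, by \<open>1\<close>, and then the next
  round makes up for it.
\<close>

context graph
begin

section \<open>Neighbourhoods as vertex sets\<close>

definition nbrs :: "'a \<Rightarrow> 'a set" where
  "nbrs v = {u. v \<rightarrow>\<^bsub>G\<^esub> u}"

lemma nbrs_sym: "u \<in> nbrs v \<longleftrightarrow> v \<in> nbrs u"
  unfolding nbrs_def using graph_symmetric by blast

lemma nbrs_irrefl: "v \<notin> nbrs v"
  unfolding nbrs_def by (auto dest: adj_not_same)

lemma nbrs_subset_verts: "nbrs v \<subseteq> verts G"
  unfolding nbrs_def by (auto dest: adj_in_verts)

lemma nbrs_in_verts: "u \<in> nbrs v \<Longrightarrow> v \<in> verts G"
  unfolding nbrs_def by (auto dest: adj_in_verts)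

lemma finite_nbrs [simp]: "finite (nbrs v)"
  using nbrs_subset_verts finite_verts by (rule finite_subset)

lemma out_degree_eq_card_nbrs: "out_degree G v = card (nbrs v)"
proof -
  have "nbrs v = head G ` out_arcs G v"
    unfolding nbrs_def out_arcs_def arcs_ends_conv by auto
  moreover have "inj_on (head G) (out_arcs G v)"
    by (rule inj_onI) (auto simp: out_arcs_def arc_to_ends_def intro: no_multi_arcs)
  ultimately show ?thesis
    by (simp add: out_degree_def card_image)
qed

lemma neighborhood_eq_nbrs: "neighborhood S = (\<Union>s\<in>S. nbrs s)"
  unfolding neighborhood_def using nbrs_sym nbrs_subset_verts unfolding nbrs_def by blast

section \<open>Active, pending and live vertices, and the legal moves in terms of them\<close>

definition uncovered :: "'a set \<Rightarrow> 'a set" where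
  "uncovered S = verts G - neighborhood S"

definition active :: "'a set \<Rightarrow> 'a set" where
  "active S = {u \<in> uncovered S. nbrs u \<inter> uncovered S \<noteq> {}}"

definition pending :: "'a set \<Rightarrow> 'a set" where
  "pending S = S \<inter> uncovered S"

definition live :: "'a set \<Rightarrow> 'a set" where
  "live S = {w \<in> neighborhood S. nbrs w \<inter> active S \<noteq> {}}"

lemma nbrs_pending: "s \<in> pending S \<Longrightarrow> nbrs s \<subseteq> neighborhood S"
  unfolding pending_def neighborhood_eq_nbrs by blast

text \<open>In a component with a second vertex, the first arc of a path from \<open>u\<close> to
  that vertex gives \<open>u\<close> an undominated neighbour. Conversely, two adjacent undominated
  vertices reach each other and share a component.\<close>

lemma big_component_iff_active:
  "(\<exists>C \<in> pre_digraph.sccs (residual S). u \<in> verts C \<and> card (verts C) \<ge> 2) \<longleftrightarrow> u \<in> active S"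
proof -
  let ?U = "uncovered S"
  have res: "residual S = G \<restriction> ?U"
    by (simp add: residual_def uncovered_def)
  have "induced_subgraph (residual S) G"
    unfolding res by (rule induced_induce) (auto simp: uncovered_def)
  then interpret R: sym_digraph "residual S"
    by (rule induced_graph_imp_graph)
  have vR: "verts (residual S) = ?U"
    by (simp add: res)
  have adj: "a \<rightarrow>\<^bsub>residual S\<^esub> b \<longleftrightarrow> a \<in> ?U \<and> b \<in> ?U \<and> b \<in> nbrs a" for a b
    unfolding res nbrs_def arcs_ends_conv by auto
  show ?thesis
  proof
    assume "\<exists>C \<in> R.sccs. u \<in> verts C \<and> card (verts C) \<ge> 2"
    then obtain C where C: "C \<in> R.sccs" "u \<in> verts C" "card (verts C) \<ge> 2" by blast
    have "\<not> verts C \<subseteq> {u}"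
      using C(3) card_mono[of "{u}" "verts C"] by auto
    then obtain u' where u': "u' \<in> verts C" "u' \<noteq> u" by blast
    have "verts C \<in> R.sccs_verts"
      using C(1) by (simp add: R.sccs_verts_conv)
    then have "u \<rightarrow>\<^sup>*\<^bsub>residual S\<^esub> u'"
      using C(2) u'(1) unfolding R.in_sccs_verts_conv_reachable by blast
    then obtain b where "u \<rightarrow>\<^bsub>residual S\<^esub> b"
      using u'(2) by (metis R.converse_reachable_cases)
    then show "u \<in> active S"
      unfolding adj active_def by blast
  next
    assume "u \<in> active S"
    then obtain b where b: "u \<in> ?U" "b \<in> ?U" "b \<in> nbrs u"
      unfolding active_def by blast
    then have ub: "u \<rightarrow>\<^bsub>residual S\<^esub> b" and bu: "b \<rightarrow>\<^bsub>residual S\<^esub> u"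
      unfolding adj using nbrs_sym by auto
    have "R.scc_of u \<in> R.sccs_verts"
      using b(1) by (intro R.scc_of_in_sccs_verts) (simp add: vR)
    then obtain C where C: "C \<in> R.sccs" "verts C = R.scc_of u"
      unfolding R.sccs_verts_conv by force
    have sub: "{u, b} \<subseteq> R.scc_of u"
      using ub bu b(1) by (auto simp: R.scc_of_def vR)
    have "R.scc_of u \<subseteq> ?U"
      unfolding R.scc_of_def using vR R.reachable_in_verts by blast
    then have "finite (R.scc_of u)"
      by (rule finite_subset) (simp add: uncovered_def)
    moreover have "card {u, b} = 2"
      using b(3) nbrs_irrefl by (simp add: card_2_iff) metis
    ultimately have "card (verts C) \<ge> 2"
      unfolding C(2) using card_mono sub by metis
    then show "\<exists>C \<in> R.sccs. u \<in> verts C \<and> card (verts C) \<ge> 2"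
      using C sub by auto
  qed
qed

text \<open>Every neighbour of a played vertex is dominated, so a played undominated vertex is
  automatically isolated in the residual graph. This is why \<open>pending\<close> does not mention
  isolation.\<close>

lemma playable_iff: "v \<in> playable S \<longleftrightarrow> nbrs v \<inter> (active S \<union> pending S) \<noteq> {}"
proof -
  have "out_degree (residual S) u = 0" if "u \<in> pending S" for u
  proof -
    have "out_arcs (residual S) u = {}"
      using nbrs_pending[OF that]
      unfolding out_arcs_def residual_def nbrs_def arcs_ends_conv by auto
    then show ?thesis
      by (simp add: out_degree_def)
  qed
  moreover have "verts (residual S) = uncovered S"
    by (simp add: residual_def uncovered_def)
  ultimately show ?thesis
    unfolding playable_def big_component_iff_active
    by (auto simp: nbrs_def pending_def dest: adj_in_verts)
qed

section \<open>How a move changes the three kinds of vertices\<close>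

lemma uncovered_insert: "uncovered (insert v S) = uncovered S - nbrs v"
  by (auto simp: uncovered_def neighborhood_eq_nbrs)

lemma neighborhood_insert: "neighborhood (insert v S) = nbrs v \<union> neighborhood S"
  by (auto simp: neighborhood_eq_nbrs)

lemma finite_uncovered [simp]: "finite (uncovered S)"
  by (simp add: uncovered_def)

lemma finite_active [simp]: "finite (active S)"
  by (rule finite_subset[OF _ finite_uncovered[of S]]) (auto simp: active_def)

lemma finite_pending [simp]: "finite (pending S)"
  by (rule finite_subset[OF _ finite_uncovered[of S]]) (auto simp: pending_def)

lemma finite_live [simp]: "finite (live S)"
  by (rule finite_subset[OF _ finite_verts]) (auto simp: live_def neighborhood_def)

lemma activeI: "u \<in> uncovered S \<Longrightarrow> v \<in> uncovered S \<Longrightarrow> v \<in> nbrs u \<Longrightarrow> u \<in> active S"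
  by (auto simp: active_def)

lemma active_uncovered: "u \<in> active S \<Longrightarrow> u \<in> uncovered S"
  by (simp add: active_def)

lemma active_not_covered: "u \<in> active S \<Longrightarrow> u \<notin> neighborhood S"
  by (simp add: active_def uncovered_def)

lemma active_nbrE:
  assumes "u \<in> active S"
  obtains u' where "u' \<in> nbrs u" "u' \<in> active S"
  using assms nbrs_sym unfolding active_def by blast

lemma nbrs_active: "u \<in> active S \<Longrightarrow> nbrs u - active S \<subseteq> neighborhood S"
  using nbrs_subset_verts nbrs_sym unfolding active_def uncovered_def by blast

lemma nbrs_active_live:
  "u \<in> active S \<Longrightarrow> nbrs u - active S \<subseteq> live S"
  using nbrs_active nbrs_sym unfolding live_def by blast

lemma not_active_if_played: "v \<in> S \<Longrightarrow> v \<notin> active S"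
  by (auto simp: active_def uncovered_def neighborhood_eq_nbrs)

lemma not_active_insert_nbr: "u \<in> nbrs v \<Longrightarrow> u \<notin> active (insert v S)"
  by (auto simp: active_def uncovered_insert)

lemma not_active_insert_isolated:
  assumes "nbrs u \<inter> active S \<subseteq> nbrs v" shows "u \<notin> active (insert v S)"
  using assms nbrs_sym unfolding active_def uncovered_insert by blast

lemma active_insert_subset: "active (insert v S) \<subseteq> active S - nbrs v"
  by (auto simp: active_def uncovered_insert)

lemma active_nbrs_pending: "v \<in> active S \<Longrightarrow> nbrs v \<inter> pending S = {}"
  using nbrs_pending nbrs_sym active_not_covered by blast

lemma live_nbrE:
  assumes "w \<in> live S"
  obtains u where "u \<in> nbrs w" "u \<in> active S" "w \<in> neighborhood S"
  using assms by (auto simp: live_def)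

lemma not_liveI: "nbrs w \<inter> active S = {} \<Longrightarrow> w \<notin> live S"
  by (auto simp: live_def)

lemma pending_insert_covered:
  assumes "v \<in> neighborhood S" shows "pending (insert v S) = pending S - nbrs v"
proof -
  have "v \<notin> uncovered S"
    using assms by (simp add: uncovered_def)
  then show ?thesis
    by (auto simp: pending_def uncovered_insert)
qed

lemma pending_insert_active:
  assumes "v \<in> active S" shows "pending (insert v S) = insert v (pending S)"
  using active_nbrs_pending[OF assms] active_uncovered[OF assms] nbrs_irrefl
  unfolding pending_def uncovered_insert by blast

text \<open>A newly live vertex already had an active neighbour before the move, so it would have
  been live had it been dominated. Hence it is dominated by this very move, and before the move it
  was itself active.\<close>

lemma newly_live: "live (insert v S) - live S \<subseteq> nbrs v \<inter> active S"
proof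
  fix w assume w: "w \<in> live (insert v S) - live S"
  then obtain u where u: "u \<in> nbrs w" "u \<in> active S"
    using active_insert_subset by (blast elim: live_nbrE)
  with w have "w \<notin> neighborhood S"
    by (auto simp: live_def)
  moreover from this w have "w \<in> nbrs v"
    by (auto simp: live_def neighborhood_insert)
  moreover have "w \<in> verts G"
    using u(1) by (rule nbrs_in_verts)
  ultimately show "w \<in> nbrs v \<inter> active S"
    using u(1) active_uncovered[OF u(2)] activeI[of w S u] by (auto simp: uncovered_def)
qed

text \<open>A pending neighbour would dominate the vertex, so an undominated playable vertex owes
  its legality to an active neighbour, which makes it active too.\<close>

lemma playable_cases:
  assumes "v \<in> playable S"
  obtains (covered) "v \<in> neighborhood S" "nbrs v \<inter> (active S \<union> pending S) \<noteq> {}"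
  | (active) "v \<in> active S"
proof -
  from assms obtain u where u: "u \<in> nbrs v" "u \<in> active S \<union> pending S"
    unfolding playable_iff by blast
  show thesis
  proof (cases "v \<in> neighborhood S")
    case True
    then show ?thesis using u covered by blast
  next
    case False
    then have "u \<notin> pending S" "v \<in> uncovered S"
      using u(1) nbrs_pending[of u S] nbrs_sym[of u v] nbrs_in_verts by (auto simp: uncovered_def)
    then show ?thesis
      using u active_uncovered active activeI[of v S u] by blast
  qed
qed

lemma playable_if_active_nbr: "u \<in> nbrs v \<Longrightarrow> u \<in> active S \<Longrightarrow> v \<in> playable S"
  unfolding playable_iff by blast

section \<open>The minimax recursion\<close>

lemma remaining_moves_Dominator_le:
  assumes "v \<in> playable S"
  shows "remaining_moves Dominator S \<le> Suc (remaining_moves Staller (insert v S))"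
proof -
  have "finite (playable S)"
    by (rule finite_subset[OF _ finite_verts]) (auto simp: playable_def)
  then show ?thesis
    using assms by (subst remaining_moves.simps) auto
qed

lemma remaining_moves_StallerE:
  obtains "remaining_moves Staller S = 0"
  | v where "v \<in> playable S" "remaining_moves Staller S = Suc (remaining_moves Dominator (insert v S))"
proof (cases "playable S = {}")
  case True
  then show ?thesis using that(1) by (simp add: remaining_moves.simps)
next
  case False
  let ?A = "(\<lambda>v. remaining_moves Dominator (insert v S)) ` playable S"
  have "finite (playable S)"
    by (rule finite_subset[OF _ finite_verts]) (auto simp: playable_def)
  then have "Max ?A \<in> ?A"
    using False by (intro Max_in) auto
  then show ?thesis
    using False that(2) by (auto simp: remaining_moves.simps(2)[of S])
qed

text \<open>Without active vertices only a dominated neighbour of a pending vertex can be played.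
  Each move therefore removes a pending vertex and creates none, whoever plays.\<close>

lemma remaining_moves_no_active:
  assumes "active S = {}"
  shows "remaining_moves p S \<le> card (pending S)"
  using assms
proof (induction "card (pending S)" arbitrary: S p rule: less_induct)
  case less
  have step: "remaining_moves q (insert v S) < card (pending S)" if "v \<in> playable S" for v q
    using that
  proof (cases rule: playable_cases)
    case covered
    then have pend: "pending (insert v S) \<subset> pending S"
      using less.prems by (auto simp: pending_insert_covered)
    have "active (insert v S) = {}"
      using active_insert_subset[of v S] less.prems by blast
    then show ?thesis
      using less.hyps[of "insert v S" q] psubset_card_mono[OF _ pend] by simp
  qed (use less.prems in simp)
  show ?case
  proof (cases "p = Dominator")
    case True
    show ?thesis
    proof (cases "playable S = {}")
      case False
      then obtain v where v: "v \<in> playable S" by blast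
      show ?thesis
        using remaining_moves_Dominator_le[OF v] step[OF v, of Staller] True by simp
    qed (simp add: True remaining_moves.simps)
  next
    case False
    then have p: "p = Staller" by (cases p) auto
    show ?thesis
      unfolding p by (rule remaining_moves_StallerE[of S]) (use step in \<open>auto simp: Suc_le_eq\<close>)
  qed
qed

end

section \<open>The potential and its change under a move\<close>

text \<open>Inside the locale \<open>\<delta>\<close> is just a lower bound, at least 2, on all
  degrees; it becomes the minimum degree in the final theorem.\<close>

locale min_degree_graph = graph G for G :: "('a, 'b) pre_digraph" (structure) +
  fixes \<delta> :: nat
  assumes two_le_delta: "2 \<le> \<delta>"
    and delta_le_card_nbrs: "v \<in> verts G \<Longrightarrow> \<delta> \<le> card (nbrs v)"
    and connected_graph: "Digraph_Component.connected G"
begin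

lemma two_le_int_delta: "2 \<le> int \<delta>"
  using two_le_delta by simp

text \<open>Everything is scaled by \<open>3 * int \<delta> - 2\<close>, so one move costs that
  amount and the arithmetic stays in the integers. A pending vertex weighs exactly one move, and the
  weight of an active vertex is the numerator of the coefficient of \<open>n\<close> in the final
  bound.\<close>

definition potential :: "'a set \<Rightarrow> int" where
  "potential S = (2 * int \<delta> - 1) * int (card (active S))
     + (3 * int \<delta> - 2) * int (card (pending S)) + int (card (live S))"

text \<open>Stated as an inequality so that \<open>X\<close> may be any set of known losses instead
  of all of \<open>A - B\<close>.\<close>

lemma card_accounting:
  assumes "finite A" "finite B" "X \<subseteq> A - B"
  shows "int (card B) + int (card X) \<le> int (card A) + int (card (B - A))"
proof -
  have "card B + card X = card (B \<union> X)"
    using assms finite_subset[of X A] by (intro card_Un_disjoint[symmetric]) auto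
  also have "\<dots> \<le> card (A \<union> (B - A))"
    using assms by (intro card_mono) auto
  also have "\<dots> = card A + card (B - A)"
    using assms by (intro card_Un_disjoint) auto
  finally show ?thesis by simp
qed

text \<open>No vertex becomes active, so apart from the pending ones the only possible increase
  comes from newly live vertices. The pending terms stay on both sides because that set grows or
  shrinks according to the type of move.\<close>

lemma potential_insert:
  assumes X: "X \<subseteq> active S - active (insert v S)"
    and D: "D \<subseteq> live S - live (insert v S)"
  shows "potential (insert v S) + (2 * int \<delta> - 1) * int (card X) + int (card D)
      + (3 * int \<delta> - 2) * int (card (pending S))
    \<le> potential S + (3 * int \<delta> - 2) * int (card (pending (insert v S)))
      + int (card (live (insert v S) - live S))"
proof -
  have "active (insert v S) - active S = {}"
    using active_insert_subset by blast
  then have "int (card (active (insert v S))) + int (card X) \<le> int (card (active S))"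
    using card_accounting[OF finite_active finite_active X]
    by (simp only: card.empty of_nat_0 add_0_right)
  then have "(2 * int \<delta> - 1) * (int (card (active (insert v S))) + int (card X))
      \<le> (2 * int \<delta> - 1) * int (card (active S))"
    using two_le_delta by (intro mult_left_mono) auto
  moreover have "int (card (live (insert v S))) + int (card D)
      \<le> int (card (live S)) + int (card (live (insert v S) - live S))"
    using card_accounting[OF finite_live finite_live D] .
  ultimately show ?thesis
    unfolding potential_def by (simp add: distrib_left)
qed

lemma potential_insert_active:
  assumes "v \<in> active S" "X \<subseteq> active S - active (insert v S)"
    "D \<subseteq> live S - live (insert v S)"
  shows "potential (insert v S) + (2 * int \<delta> - 1) * int (card X) + int (card D)
    \<le> potential S + (3 * int \<delta> - 2) + int (card (live (insert v S) - live S))"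
proof -
  have "v \<notin> pending S"
    using not_active_if_played assms(1) by (auto simp: pending_def)
  then have "card (pending (insert v S)) = Suc (card (pending S))"
    using pending_insert_active[OF assms(1)] by simp
  then show ?thesis
    using potential_insert[OF assms(2,3)] by (simp add: algebra_simps)
qed

lemma potential_insert_covered:
  assumes "v \<in> neighborhood S" "X \<subseteq> active S - active (insert v S)"
    "D \<subseteq> live S - live (insert v S)"
  shows "potential (insert v S) + (2 * int \<delta> - 1) * int (card X) + int (card D)
      + (3 * int \<delta> - 2) * int (card (nbrs v \<inter> pending S))
    \<le> potential S + int (card (live (insert v S) - live S))"
proof -
  have "card (pending (insert v S)) + card (nbrs v \<inter> pending S) = card (pending S)"
    unfolding pending_insert_covered[OF assms(1)]
    by (subst card_Un_disjoint[symmetric]) (auto intro: arg_cong[where f = card])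
  then have "(3 * int \<delta> - 2) * int (card (pending (insert v S)) + card (nbrs v \<inter> pending S))
      = (3 * int \<delta> - 2) * int (card (pending S))"
    by simp
  then show ?thesis
    using potential_insert[OF assms(2,3)] by (simp add: distrib_left)
qed

lemma card_newly_live: "card (live (insert v S) - live S) \<le> card (nbrs v \<inter> active S)"
  using newly_live by (intro card_mono) auto

text \<open>An active neighbour of \<open>v\<close> loses weight \<open>2 * int \<delta> - 1\<close>
  but may become live, which leaves a net \<open>2 * int \<delta> - 2\<close>. The extra 1 is
  \<open>v\<close> itself: all its neighbours are now dominated, so it stops being live.\<close>

lemma potential_insert_covered':
  assumes v: "v \<in> neighborhood S"
  shows "potential (insert v S) + (2 * int \<delta> - 2) * int (card (nbrs v \<inter> active S))
      + (if nbrs v \<inter> active S = {} then 0 else 1)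
      + (3 * int \<delta> - 2) * int (card (nbrs v \<inter> pending S))
    \<le> potential S"
proof -
  define D where "D = (if nbrs v \<inter> active S = {} then {} else {v})"
  have "nbrs v \<inter> active (insert v S) = {}"
    using active_insert_subset by blast
  then have "D \<subseteq> live S - live (insert v S)"
    using v not_liveI by (auto simp: D_def live_def)
  then have "potential (insert v S) + (2 * int \<delta> - 1) * int (card (nbrs v \<inter> active S)) + int (card D)
      + (3 * int \<delta> - 2) * int (card (nbrs v \<inter> pending S))
    \<le> potential S + int (card (live (insert v S) - live S))"
    using not_active_insert_nbr by (intro potential_insert_covered[OF v]) auto
  moreover have "int (card D) = (if nbrs v \<inter> active S = {} then 0 else 1)"
    by (simp add: D_def)
  ultimately show ?thesis
    using card_newly_live[of v S] by (simp add: algebra_simps)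
qed

text \<open>
  The surplus \<open>\<delta> - 1\<close> when Staller is to move makes both inequalities inductive: Dominator
  has to lower the potential by \<open>4\<delta> - 3\<close>, while Staller cannot avoid lowering it by \<open>2\<delta> - 1\<close>
  or leaving a pending vertex with a live neighbour.
\<close>

definition dominator_bounded :: "'a set \<Rightarrow> bool" where
  "dominator_bounded S \<longleftrightarrow> (3 * int \<delta> - 2) * int (remaining_moves Dominator S) \<le> potential S"

definition staller_bounded :: "'a set \<Rightarrow> bool" where
  "staller_bounded S \<longleftrightarrow>
     (3 * int \<delta> - 2) * int (remaining_moves Staller S) \<le> potential S + int \<delta> - 1"

lemma potential_nonneg: "0 \<le> potential S"
  unfolding potential_def using two_le_delta by (intro add_nonneg_nonneg mult_nonneg_nonneg) auto

text \<open>The amount \<open>4 * int \<delta> - 3\<close> is the cost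
  \<open>3 * int \<delta> - 2\<close> of the move plus the surplus \<open>int \<delta> - 1\<close>
  granted when Staller is to move.\<close>

lemma dominator_move:
  assumes "v \<in> playable S" "staller_bounded (insert v S)"
  shows "(3 * int \<delta> - 2) * int (remaining_moves Dominator S)
    \<le> potential (insert v S) + 4 * int \<delta> - 3"
proof -
  have "(3 * int \<delta> - 2) * int (remaining_moves Dominator S)
      \<le> (3 * int \<delta> - 2) * int (Suc (remaining_moves Staller (insert v S)))"
    using remaining_moves_Dominator_le[OF assms(1)] two_le_delta by (intro mult_left_mono) auto
  then show ?thesis
    using assms(2) by (simp add: staller_bounded_def algebra_simps)
qed

text \<open>Playing \<open>w\<close> releases \<open>3 * int \<delta> - 2\<close> from
  \<open>s\<close>, at least \<open>2 * int \<delta> - 2\<close> net from an active neighbour, and 1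
  from \<open>w\<close>. The sum \<open>5 * int \<delta> - 3\<close> exceeds the required
  \<open>4 * int \<delta> - 3\<close> by \<open>int \<delta>\<close>.\<close>

lemma dominator_bounded_pending:
  assumes s: "s \<in> pending S" and w: "w \<in> nbrs s" "w \<in> live S"
    and IH: "staller_bounded (insert w S)"
  shows "(3 * int \<delta> - 2) * int (remaining_moves Dominator S) \<le> potential S - int \<delta>"
proof -
  obtain u where u: "u \<in> nbrs w" "u \<in> active S" "w \<in> neighborhood S"
    using w(2) by (rule live_nbrE)
  have "s \<in> nbrs w \<inter> pending S" "u \<in> nbrs w \<inter> active S"
    using s w u nbrs_sym by auto
  then have "1 \<le> card (nbrs w \<inter> pending S)" "1 \<le> card (nbrs w \<inter> active S)"
    and ne: "nbrs w \<inter> active S \<noteq> {}"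
    by (auto simp: Suc_le_eq card_gt_0_iff)
  then have "(3 * int \<delta> - 2) * 1 \<le> (3 * int \<delta> - 2) * int (card (nbrs w \<inter> pending S))"
    "(2 * int \<delta> - 2) * 1 \<le> (2 * int \<delta> - 2) * int (card (nbrs w \<inter> active S))"
    using two_le_delta by (auto intro!: mult_left_mono)
  then have "potential (insert w S) + (5 * int \<delta> - 3) \<le> potential S"
    using potential_insert_covered'[OF u(3)] ne by simp
  then show ?thesis
    using dominator_move[OF playable_if_active_nbr[OF u(1,2)] IH] by simp
qed

section \<open>Positions with Staller to move\<close>

lemma staller_boundedI:
  assumes "S \<subseteq> verts G"
    and IH: "\<And>T. S \<subset> T \<Longrightarrow> T \<subseteq> verts G \<Longrightarrow> dominator_bounded T \<and> staller_bounded T"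
  shows "staller_bounded S"
proof (rule remaining_moves_StallerE[of S])
  assume "remaining_moves Staller S = 0"
  then show ?thesis
    using potential_nonneg[of S] two_le_delta by (simp add: staller_bounded_def)
next
  fix x assume x: "x \<in> playable S"
    and rm: "remaining_moves Staller S = Suc (remaining_moves Dominator (insert x S))"
  let ?S' = "insert x S"
  let ?r = "(3 * int \<delta> - 2) * int (remaining_moves Dominator ?S')"
  have S': "S \<subset> ?S'" "?S' \<subseteq> verts G"
    using playable_fresh[OF x] assms(1) by auto
  have r: "?r \<le> potential ?S'"
    using IH[OF S'] by (simp add: dominator_bounded_def)
  \<comment> \<open>The required decrease is the cost \<open>3 * int \<delta> - 2\<close> of a move
    minus the surplus \<open>int \<delta> - 1\<close>.\<close>
  have goal: "staller_bounded S" if "?r + 2 * int \<delta> - 1 \<le> potential S"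
    using that by (simp add: staller_bounded_def rm algebra_simps)
  from x show ?thesis
  proof (cases rule: playable_cases)
    case covered
    let ?p = "card (nbrs x \<inter> pending S)" and ?j = "card (nbrs x \<inter> active S)"
    have "2 * int \<delta> - 1 \<le> (2 * int \<delta> - 2) * int ?j
      + (if nbrs x \<inter> active S = {} then 0 else 1) + (3 * int \<delta> - 2) * int ?p"
    proof (cases "nbrs x \<inter> active S = {}")
      case True
      then have "1 \<le> ?p"
        using covered(2) by (auto simp: Suc_le_eq card_gt_0_iff)
      then have "1 * (3 * int \<delta> - 2) \<le> int ?p * (3 * int \<delta> - 2)"
        using two_le_delta by (intro mult_right_mono) auto
      then show ?thesis
        using True two_le_delta by (simp add: algebra_simps)
    next
      case False
      then have "1 \<le> ?j"
        by (auto simp: Suc_le_eq card_gt_0_iff)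
      then have "(2 * int \<delta> - 2) * 1 \<le> (2 * int \<delta> - 2) * int ?j"
        using two_le_delta by (intro mult_left_mono) auto
      moreover have "0 \<le> (3 * int \<delta> - 2) * int ?p"
        using two_le_delta by auto
      ultimately show ?thesis using False by simp
    qed
    then show ?thesis
      using potential_insert_covered'[OF covered(1)] r by (intro goal) linarith
  next
    case active
    define J where "J = nbrs x \<inter> active S"
    define D where "D = nbrs x \<inter> live S - live ?S'"
    have "J \<noteq> {}"
      using active_nbrE[OF active] by (auto simp: J_def)
    then have J: "1 \<le> card J" "finite J"
      by (auto simp: Suc_le_eq card_gt_0_iff J_def)
    have X: "insert x J \<subseteq> active S - active ?S'" "card (insert x J) = Suc (card J)"
      using active not_active_if_played[of x ?S'] not_active_insert_nbr[of _ x S] nbrs_irrefl J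
      by (auto simp: J_def)
    have acc: "potential ?S' + (2 * int \<delta> - 1) * (1 + int (card J)) + int (card D)
      \<le> potential S + (3 * int \<delta> - 2) + int (card (live ?S' - live S))"
      using potential_insert_active[OF active X(1), of D] X(2) by (auto simp: D_def)
    have xp: "x \<in> pending ?S'"
      using pending_insert_active[OF active] by simp
    have "(2 * int \<delta> - 2) * 1 \<le> (2 * int \<delta> - 2) * int (card J)"
      using J two_le_delta by (intro mult_left_mono) auto
    \<comment> \<open>After paying \<open>3 * int \<delta> - 2\<close> for the new pending vertex
      \<open>x\<close>, this guarantees a drop of only \<open>int \<delta> - 1\<close>. The missing
      \<open>int \<delta>\<close> comes from Dominator's reply at a live neighbour of
      \<open>x\<close> if there is one, and otherwise from the degree of \<open>x\<close>.\<close>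
    then have J': "4 * int \<delta> - 3 \<le> (2 * int \<delta> - 1) * (1 + int (card J)) - int (card J)"
      by (simp add: algebra_simps)
    show ?thesis
    proof (cases "nbrs x \<inter> live ?S' = {}")
      case False
      then obtain w where w: "w \<in> nbrs x" "w \<in> live ?S'" by blast
      have "w \<in> playable ?S'"
        using w(2) by (blast elim: live_nbrE intro: playable_if_active_nbr)
      then have "staller_bounded (insert w ?S')"
        using IH[of "insert w ?S'"] S' playable_fresh by blast
      from dominator_bounded_pending[OF xp w this]
      have "?r \<le> potential ?S' - int \<delta>" .
      then show ?thesis
        using acc J' card_newly_live[of x S] by (intro goal) (simp add: J_def)
    next
      case True
      then have "live ?S' - live S = {}"
        using newly_live[of x S] by blast
      then have "int (card (live ?S' - live S)) = 0"
        by (simp only: card.empty of_nat_0)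
      \<comment> \<open>Each dominated neighbour of the active vertex \<open>x\<close> was live and
        no longer is. Hence every neighbour of \<open>x\<close> contributes 1 to the drop: those in
        \<open>D\<close> by ceasing to be live, those in \<open>J\<close> by not becoming
        live.\<close>
      moreover have "nbrs x \<subseteq> D \<union> J"
        using nbrs_active_live[OF active] True by (auto simp: D_def J_def)
      then have "card (nbrs x) \<le> card (D \<union> J)"
        by (intro card_mono) (auto simp: D_def J_def)
      then have "int \<delta> \<le> int (card D) + int (card J)"
        using delta_le_card_nbrs[of x] card_Un_le[of D J] active_uncovered[OF active]
        by (simp add: uncovered_def)
      ultimately show ?thesis
        using acc J' r by (intro goal) linarith
    qed
  qed
qed

section \<open>Good moves of Dominator on vertices of high degree and near leaves\<close>

definition has_good_move :: "'a set \<Rightarrow> bool" where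
  "has_good_move S \<longleftrightarrow> (\<exists>v\<in>playable S. potential (insert v S) + 4 * int \<delta> - 3 \<le> potential S)"

lemma dominator_bounded_if_good_move:
  assumes "has_good_move S"
    and "\<And>v. v \<in> playable S \<Longrightarrow> staller_bounded (insert v S)"
  shows "dominator_bounded S"
proof -
  obtain v where v: "v \<in> playable S" "potential (insert v S) + 4 * int \<delta> - 3 \<le> potential S"
    using assms(1) unfolding has_good_move_def by blast
  then show ?thesis
    using dominator_move[OF v(1) assms(2)[OF v(1)]] by (simp add: dominator_bounded_def)
qed

lemma playable_active: "v \<in> active S \<Longrightarrow> v \<in> playable S"
  by (blast elim: active_nbrE intro: playable_if_active_nbr)

text \<open>The threshold \<open>7 * int \<delta> - 5\<close> is the required drop
  \<open>4 * int \<delta> - 3\<close> plus the weight \<open>3 * int \<delta> - 2\<close> of the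
  played vertex, which becomes pending.\<close>

lemma good_move_active:
  assumes v: "v \<in> active S" and X: "X \<subseteq> active S - active (insert v S)"
    and D: "D \<subseteq> live S - live (insert v S)"
    and drop: "7 * int \<delta> - 5 + int (card (live (insert v S) - live S))
      \<le> (2 * int \<delta> - 1) * int (card X) + int (card D)"
  shows "has_good_move S"
  unfolding has_good_move_def
  using playable_active[OF v] potential_insert_active[OF v X D] drop by (intro bexI[of _ v]) auto

text \<open>The vertex and its active neighbours release at least
  \<open>8 * int \<delta> - 7\<close> net of new live vertices, which reaches the threshold since
  \<open>\<delta> \<ge> 2\<close>.\<close>

lemma good_move_high_degree:
  assumes v: "v \<in> active S" and deg: "3 \<le> card (nbrs v \<inter> active S)"
  shows "has_good_move S"
proof (rule good_move_active[OF v])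
  let ?J = "nbrs v \<inter> active S"
  show "insert v ?J \<subseteq> active S - active (insert v S)"
    using v not_active_if_played[of v "insert v S"] not_active_insert_nbr by auto
  have "card (insert v ?J) = Suc (card ?J)"
    using nbrs_irrefl by simp
  moreover have "(2 * int \<delta> - 2) * 3 \<le> (2 * int \<delta> - 2) * int (card ?J)"
    using deg two_le_delta by (intro mult_left_mono) auto
  ultimately show "7 * int \<delta> - 5 + int (card (live (insert v S) - live S))
      \<le> (2 * int \<delta> - 1) * int (card (insert v ?J)) + int (card {})"
    using card_newly_live[of v S] two_le_int_delta by (simp add: algebra_simps)
qed auto

text \<open>Two active neighbours and the vertex itself give
  \<open>2 * (2 * int \<delta> - 2) + 1\<close>, exactly the required drop.\<close>

lemma good_move_live:
  assumes w: "w \<in> live S" and deg: "2 \<le> card (nbrs w \<inter> active S)"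
  shows "has_good_move S"
  unfolding has_good_move_def
proof
  show "w \<in> playable S"
    using w by (blast elim: live_nbrE intro: playable_if_active_nbr)
  have "(2 * int \<delta> - 2) * 2 \<le> (2 * int \<delta> - 2) * int (card (nbrs w \<inter> active S))"
    using deg two_le_delta by (intro mult_left_mono) auto
  moreover have "nbrs w \<inter> active S \<noteq> {}"
    using deg by auto
  moreover have "0 \<le> (3 * int \<delta> - 2) * int (card (nbrs w \<inter> pending S))"
    using two_le_delta by auto
  ultimately show "potential (insert w S) + 4 * int \<delta> - 3 \<le> potential S"
    using potential_insert_covered'[of w S] w by (simp add: live_def)
qed

text \<open>Neither of the two preceding moves is available. The active vertices then induce
  disjoint paths and cycles, and distinct active vertices have disjoint sets of dominated
  neighbours.\<close>

definition sparse :: "'a set \<Rightarrow> bool" where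
  "sparse S \<longleftrightarrow> (\<forall>v\<in>active S. card (nbrs v \<inter> active S) \<le> 2)
     \<and> (\<forall>w\<in>live S. card (nbrs w \<inter> active S) \<le> 1)"

lemma good_move_if_not_sparse: "\<not> sparse S \<Longrightarrow> has_good_move S"
  unfolding sparse_def using good_move_high_degree good_move_live by force

lemma sparse_live_unique:
  assumes "\<forall>w\<in>live S. card (nbrs w \<inter> active S) \<le> 1"
    and "w \<in> live S" "u \<in> nbrs w \<inter> active S" "u' \<in> nbrs w \<inter> active S"
  shows "u = u'"
  using assms card_le_Suc0_iff_eq[of "nbrs w \<inter> active S"] by auto

text \<open>A dominated neighbour of \<open>y\<close> has \<open>y\<close> as its only active
  neighbour, so it stops being live together with \<open>y\<close>.\<close>

lemma sparse_live_dies: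
  assumes "\<forall>w\<in>live S. card (nbrs w \<inter> active S) \<le> 1"
    and y: "y \<in> active S" "y \<notin> active (insert v S)"
  shows "nbrs y - active S \<subseteq> live S - live (insert v S)"
proof
  fix w assume w: "w \<in> nbrs y - active S"
  then have wl: "w \<in> live S"
    using nbrs_active_live[OF y(1)] by blast
  have "y \<in> nbrs w \<inter> active S"
    using w y(1) nbrs_sym by blast
  then have "nbrs w \<inter> active (insert v S) = {}"
    using sparse_live_unique[OF assms(1) wl] active_insert_subset[of v S] y(2) by blast
  then show "w \<in> live S - live (insert v S)"
    using wl not_liveI by blast
qed

lemma card_nbrs_covered:
  assumes "y \<in> active S"
  shows "\<delta> \<le> card (nbrs y - active S) + card (nbrs y \<inter> active S)"
proof -
  have "card (nbrs y) \<le> card (nbrs y - active S) + card (nbrs y \<inter> active S)"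
    by (rule order_trans[OF _ card_Un_le]) (simp add: Un_Diff_Int)
  moreover have "y \<in> verts G"
    using active_uncovered[OF assms] by (simp add: uncovered_def)
  ultimately show ?thesis
    using delta_le_card_nbrs by fastforce
qed

lemma good_move_leaf:
  assumes sp: "sparse S" and x: "x \<in> active S" and leaf: "nbrs x \<inter> active S = {u}"
  shows "has_good_move S"
proof -
  have u: "u \<in> active S" "u \<in> nbrs x" "x \<in> nbrs u" "u \<noteq> x"
    using leaf nbrs_sym nbrs_irrefl by blast+
  have cov: "\<delta> \<le> card (nbrs x - active S) + 1"
    using card_nbrs_covered[OF x] by (simp add: leaf)
  have live1: "\<forall>w\<in>live S. card (nbrs w \<inter> active S) \<le> 1"
    using sp by (simp add: sparse_def)
  show ?thesis
  proof (cases "nbrs u \<inter> active S = {x}")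
    case True
    \<comment> \<open>The component is a single edge. Playing a dominated neighbour \<open>w\<close>
      of \<open>x\<close> dominates \<open>x\<close>, isolates \<open>u\<close> and ends the
      liveness of \<open>w\<close>, while only \<open>x\<close> could become live.\<close>
    have "nbrs x - active S \<noteq> {}"
      using cov two_le_delta by force
    then obtain w where "w \<in> nbrs x - active S" by blast
    then have w: "w \<in> live S" "x \<in> nbrs w" "w \<in> neighborhood S"
      using nbrs_active_live[OF x] nbrs_active[OF x] nbrs_sym by blast+
    have nw: "nbrs w \<inter> active S = {x}"
      using sparse_live_unique[OF live1 w(1)] w(2) x by blast
    have "nbrs w \<inter> active (insert w S) = {}"
      using active_insert_subset[of w S] by blast
    then have "{w} \<subseteq> live S - live (insert w S)"
      using w(1) not_liveI by blast
    moreover have "{x, u} \<subseteq> active S - active (insert w S)"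
      using x u(1) not_active_insert_nbr[OF w(2)] not_active_insert_isolated[of u S w] True w(2) by auto
    moreover have "0 \<le> (3 * int \<delta> - 2) * int (card (nbrs w \<inter> pending S))"
      using two_le_delta by auto
    ultimately have "potential (insert w S) + (2 * int \<delta> - 1) * int (card {x, u}) + int (card {w})
        \<le> potential S + int (card (live (insert w S) - live S))"
      using potential_insert_covered[OF w(3), of "{x, u}" "{w}"] by linarith
    moreover have "card (live (insert w S) - live S) \<le> 1"
      using card_newly_live[of w S] by (simp add: nw)
    ultimately have "potential (insert w S) + 4 * int \<delta> - 3 \<le> potential S"
      using u(4) by simp
    then show ?thesis
      unfolding has_good_move_def using playable_if_active_nbr[OF w(2) x] by blast
  next
    case False
    then obtain y where y: "y \<in> nbrs u" "y \<in> active S" "y \<noteq> x"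
      using u x by blast
    have "{x, y} \<subseteq> nbrs u \<inter> active S" "card (nbrs u \<inter> active S) \<le> 2" "card {x, y} = 2"
      using y u x sp by (auto simp: sparse_def)
    then have nu: "nbrs u \<inter> active S = {x, y}"
      using card_seteq[of "nbrs u \<inter> active S" "{x, y}"] by simp
    have yu: "u \<in> nbrs y" "y \<noteq> u"
      using y nbrs_sym nbrs_irrefl by blast+
    show ?thesis
    proof (cases "nbrs y \<inter> active S = {u}")
      case True
      \<comment> \<open>The component is a path on three vertices and its middle vertex
        \<open>u\<close> is played. Neither end becomes live, and the dominated neighbours of
        \<open>x\<close> supply at least \<open>int \<delta> - 1\<close>.\<close>
      have X: "{u, x, y} \<subseteq> active S - active (insert u S)"
        using u x y not_active_insert_nbr not_active_if_played by auto
      have D: "nbrs x - active S \<subseteq> live S - live (insert u S)"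
        using sparse_live_dies[OF live1 x] X by blast
      have "u \<notin> active (insert u S)"
        by (simp add: not_active_if_played)
      then have "x \<notin> live (insert u S)" "y \<notin> live (insert u S)"
        using leaf True active_insert_subset[of u S] by (auto intro!: not_liveI)
      then have "live (insert u S) - live S = {}"
        using newly_live[of u S, unfolded nu] by blast
      then have N: "int (card (live (insert u S) - live S)) = 0"
        by (simp only: card.empty of_nat_0)
      have X3: "int (card {u, x, y}) = 3"
        using u y yu by simp
      show ?thesis
      proof (rule good_move_active[OF u(1) X D])
        show "7 * int \<delta> - 5 + int (card (live (insert u S) - live S))
            \<le> (2 * int \<delta> - 1) * int (card {u, x, y}) + int (card (nbrs x - active S))"
          unfolding N X3 using cov two_le_int_delta by simp
      qed
    next
      case False
      then obtain z where z: "z \<in> nbrs y" "z \<in> active S" "z \<noteq> u"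
        using yu u by blast
      have "{u, z} \<subseteq> nbrs y \<inter> active S" "card (nbrs y \<inter> active S) \<le> 2" "card {u, z} = 2"
        using z yu u y sp by (auto simp: sparse_def)
      then have ny: "nbrs y \<inter> active S = {u, z}"
        using card_seteq[of "nbrs y \<inter> active S" "{u, z}"] by simp
      have zx: "z \<noteq> x" "z \<noteq> y"
        using z(1) y(2) leaf yu(2) nbrs_sym nbrs_irrefl by blast+
      \<comment> \<open>The path continues to \<open>z\<close>. Playing \<open>y\<close>, at
        distance two from the leaf, also isolates \<open>x\<close>, so four active vertices are lost
        while at most two vertices become live.\<close>
      have X: "{u, x, y, z} \<subseteq> active S - active (insert y S)"
        using u x y z yu not_active_insert_nbr not_active_if_played
          not_active_insert_isolated[of x S y] leaf by auto
      have "card {u, x, y, z} = 4"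
        using u y z yu zx by auto
      moreover have "card (live (insert y S) - live S) \<le> 2"
        using card_newly_live[of y S] z(3) by (simp add: ny)
      ultimately show ?thesis
        using two_le_int_delta by (intro good_move_active[OF y(2) X, of "{}"]) auto
    qed
  qed
qed

section \<open>The exceptional round for \<delta> = 2\<close>

text \<open>Here the surplus \<open>int \<delta> - 1\<close>, equal to 1, is saved: every move of
  Staller yields a full drop of 4. As long as \<open>v\<close> stays pending with a live neighbour,
  Dominator can reply there for an extra 2; if \<open>v\<close> stays pending and has none left,
  both \<open>a\<close> and \<open>b\<close> have stopped being live, which gives the 2
  directly.\<close>

lemma staller_two_live_nbrs:
  assumes "\<delta> = 2" and S: "S \<subseteq> verts G"
    and live1: "\<forall>w\<in>live S. card (nbrs w \<inter> active S) \<le> 1"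
    and v: "v \<in> pending S" and ab: "a \<in> nbrs v \<inter> live S" "b \<in> nbrs v \<inter> live S" "a \<noteq> b"
    and IH: "\<And>T. S \<subset> T \<Longrightarrow> T \<subseteq> verts G \<Longrightarrow> dominator_bounded T \<and> staller_bounded T"
  shows "4 * int (remaining_moves Staller S) \<le> potential S"
proof (rule remaining_moves_StallerE[of S])
  assume "remaining_moves Staller S = 0"
  then show ?thesis
    using potential_nonneg[of S] by simp
next
  fix x assume x: "x \<in> playable S"
    and rm: "remaining_moves Staller S = Suc (remaining_moves Dominator (insert x S))"
  let ?S' = "insert x S"
  let ?r = "4 * int (remaining_moves Dominator ?S')"
  have S': "S \<subset> ?S'" "?S' \<subseteq> verts G"
    using playable_fresh[OF x] S by auto
  have r: "?r \<le> potential ?S'"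
    using IH[OF S'] \<open>\<delta> = 2\<close> unfolding dominator_bounded_def by simp
  have r': "?r \<le> potential ?S' - 2" if "s \<in> pending ?S'" "nbrs s \<inter> live ?S' \<noteq> {}" for s
  proof -
    obtain w where w: "w \<in> nbrs s" "w \<in> live ?S'"
      using \<open>nbrs s \<inter> live ?S' \<noteq> {}\<close> by blast
    have "w \<in> playable ?S'"
      using w(2) by (blast elim: live_nbrE intro: playable_if_active_nbr)
    then have "staller_bounded (insert w ?S')"
      using IH[of "insert w ?S'"] S' playable_fresh by blast
    from dominator_bounded_pending[OF that(1) w this] show ?thesis
      using \<open>\<delta> = 2\<close> by simp
  qed
  have goal: ?thesis if "?r + 4 \<le> potential S"
    using that by (simp add: rm)
  have dead: "{a, b} \<subseteq> live S - live ?S'" if "nbrs v \<inter> live ?S' = {}"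
    using that ab by blast
  from x show ?thesis
  proof (cases rule: playable_cases)
    case covered
    let ?p = "card (nbrs x \<inter> pending S)" and ?J = "nbrs x \<inter> active S"
    show ?thesis
    proof (cases "nbrs x \<inter> pending S = {}")
      case False
      then have "1 \<le> ?p"
        by (auto simp: Suc_le_eq card_gt_0_iff)
      then show ?thesis
        using potential_insert_covered'[OF covered(1)] r \<open>\<delta> = 2\<close> by (intro goal) (simp split: if_splits)
    next
      case True
      then have J: "?J \<noteq> {}"
        using covered(2) by blast
      then have J1: "1 \<le> card ?J"
        by (auto simp: Suc_le_eq card_gt_0_iff)
      have vp: "v \<in> pending ?S'"
        using v True unfolding pending_insert_covered[OF covered(1)] by blast
      show ?thesis
      proof (cases "nbrs v \<inter> live ?S' = {}")
        case False
        then show ?thesis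
          using potential_insert_covered'[OF covered(1)] r'[OF vp] J J1 \<open>\<delta> = 2\<close>
          by (intro goal) (simp add: True)
      next
        case dead': True
        have "?J \<subseteq> active S - active ?S'"
          using not_active_insert_nbr by auto
        from potential_insert_covered[OF covered(1) this dead[OF dead']]
        show ?thesis
          using card_newly_live[of x S] J1 r ab(3) \<open>\<delta> = 2\<close> by (intro goal) (simp add: True)
      qed
    qed
  next
    case active
    define J where "J = nbrs x \<inter> active S"
    have "J \<noteq> {}"
      using active_nbrE[OF active] by (auto simp: J_def)
    then have J: "1 \<le> card J" "finite J"
      by (auto simp: Suc_le_eq card_gt_0_iff J_def)
    have X: "insert x J \<subseteq> active S - active ?S'" "card (insert x J) = Suc (card J)"
      using active not_active_if_played[of x ?S'] not_active_insert_nbr[of _ x S] nbrs_irrefl J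
      by (auto simp: J_def)
    have acc: "potential ?S' + 3 * int (card J) + int (card D)
        \<le> potential S + 1 + int (card (live ?S' - live S))"
      if "D \<subseteq> live S - live ?S'" for D
      using potential_insert_active[OF active X(1) that] X(2) \<open>\<delta> = 2\<close> by simp
    have N: "card (live ?S' - live S) \<le> card J"
      using card_newly_live[of x S] by (simp add: J_def)
    have xp: "x \<in> pending ?S'" "v \<in> pending ?S'"
      using pending_insert_active[OF active] v by simp_all
    show ?thesis
    proof (cases "nbrs x \<inter> live ?S' = {} \<and> nbrs v \<inter> live ?S' = {}")
      case True
      then have "live ?S' - live S = {}"
        using newly_live[of x S] by blast
      then have "int (card (live ?S' - live S)) = 0"
        by (simp only: card.empty of_nat_0)
      moreover have "int (card {a, b}) = 2"
        using ab(3) by simp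
      ultimately show ?thesis
        using acc[OF dead[OF conjunct2[OF True]]] r J(1) by (intro goal) linarith
    next
      case False
      then have r2: "?r \<le> potential ?S' - 2"
        using r' xp by blast
      show ?thesis
      proof (cases "card J = 1")
        case False
        then show ?thesis
          using acc[of "{}"] J N r2 by (intro goal) simp
      next
        case True
        \<comment> \<open>With a single active neighbour the drop without \<open>D\<close> is only
          1. Since \<open>x\<close> has degree at least 2, it also has a dominated neighbour, whose
          liveness ends and supplies the missing 1.\<close>
        have "nbrs x - active S \<subseteq> live S - live ?S'"
          using sparse_live_dies[OF live1 active] X(1) by blast
        moreover have "1 \<le> card (nbrs x - active S)"
          using card_nbrs_covered[OF active] True \<open>\<delta> = 2\<close> by (simp add: J_def)
        ultimately show ?thesis
          using acc[of "nbrs x - active S"] True N r2 by (intro goal) simp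
      qed
    qed
  qed
qed

section \<open>Dominator to move: active vertices inducing cycles, and the case analysis\<close>

lemma edge_leaving:
  assumes "u \<in> A" "A \<subseteq> verts G" "w \<in> verts G" "w \<notin> A"
  obtains a b where "a \<in> A" "b \<in> nbrs a" "b \<notin> A"
proof -
  have "strongly_connected G"
    using sym_arcs connected_graph by (rule symmetric_connected_imp_strongly_connected)
  then have "u \<rightarrow>\<^sup>*\<^bsub>G\<^esub> w"
    using assms by (auto simp: strongly_connected_def)
  then have "u \<in> A \<longrightarrow> w \<in> A" if "\<And>a b. a \<in> A \<Longrightarrow> b \<in> nbrs a \<Longrightarrow> b \<in> A"
    using that by (induction rule: converse_reachable_induct) (auto simp: nbrs_def)
  then show thesis
    using assms that by blast
qed

text \<open>A played vertex is never active, so by connectivity some edge leaves the active set, and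
  its outer end is live.\<close>

lemma exists_live:
  assumes "active S \<noteq> {}" "S \<noteq> {}" "S \<subseteq> verts G"
  obtains w where "w \<in> live S"
proof -
  obtain u s where "u \<in> active S" "s \<in> S"
    using assms by blast
  moreover have "active S \<subseteq> verts G"
    by (auto simp: active_def uncovered_def)
  ultimately obtain a b where "a \<in> active S" "b \<in> nbrs a" "b \<notin> active S"
    using edge_leaving[of u "active S" s] assms(3) not_active_if_played by blast
  then show thesis
    using that nbrs_active_live by blast
qed

text \<open>Playing \<open>v\<close> on a cycle removes \<open>v\<close>, \<open>a\<close> and
  \<open>b\<close> from the active set. Their dominated neighbours form three disjoint sets of size
  at least \<open>\<delta> - 2\<close>, all of which stop being live. The constant is
  \<open>3 * (2 * int \<delta> - 1) - (3 * int \<delta> - 2)\<close>.\<close>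

lemma no_leaf_move:
  assumes sp: "sparse S" and two: "\<forall>y\<in>active S. card (nbrs y \<inter> active S) = 2"
    and v: "v \<in> active S" and ab: "nbrs v \<inter> active S = {a, b}" "a \<noteq> b"
  obtains D where "nbrs v - active S \<subseteq> D" "D \<subseteq> live S" "3 * int \<delta> - 6 \<le> int (card D)"
    and "potential (insert v S) + 3 * int \<delta> - 1 + int (card D)
      \<le> potential S + int (card (live (insert v S) - live S))"
proof
  let ?X = "{v, a, b}"
  define D where "D = (\<Union>y\<in>?X. nbrs y - active S)"
  have live1: "\<forall>w\<in>live S. card (nbrs w \<inter> active S) \<le> 1"
    using sp by (simp add: sparse_def)
  have X: "?X \<subseteq> active S - active (insert v S)"
    using v ab(1) not_active_insert_nbr not_active_if_played[of v "insert v S"] by blast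
  have "v \<noteq> a" "v \<noteq> b"
    using ab(1) nbrs_irrefl by blast+
  then have cardX: "card ?X = 3"
    using ab(2) by simp
  have D: "D \<subseteq> live S - live (insert v S)"
    unfolding D_def using sparse_live_dies[OF live1, of _ v] X by blast
  then show "nbrs v - active S \<subseteq> D" "D \<subseteq> live S"
    by (auto simp: D_def)
  have "(nbrs y - active S) \<inter> (nbrs z - active S) = {}" if "y \<in> ?X" "z \<in> ?X" "y \<noteq> z" for y z
  proof (rule ccontr)
    assume "(nbrs y - active S) \<inter> (nbrs z - active S) \<noteq> {}"
    then obtain w where w: "w \<in> nbrs y - active S" "w \<in> nbrs z - active S" by blast
    have yz: "y \<in> active S" "z \<in> active S"
      using that X by blast+
    then have "w \<in> live S" "y \<in> nbrs w \<inter> active S" "z \<in> nbrs w \<inter> active S"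
      using w nbrs_active_live[OF yz(1)] nbrs_sym by blast+
    then show False
      using sparse_live_unique[OF live1] that(3) by blast
  qed
  then have "card D = (\<Sum>y\<in>?X. card (nbrs y - active S))"
    unfolding D_def by (intro card_UN_disjoint) auto
  moreover have "\<delta> - 2 \<le> card (nbrs y - active S)" if "y \<in> ?X" for y
    using card_nbrs_covered[of y S] two that X by force
  then have "of_nat (card ?X) * (\<delta> - 2) \<le> (\<Sum>y\<in>?X. card (nbrs y - active S))"
    by (rule sum_bounded_below)
  ultimately have "3 * (\<delta> - 2) \<le> card D"
    by (simp only: cardX of_nat_numeral)
  then show "3 * int \<delta> - 6 \<le> int (card D)"
    by linarith
  show "potential (insert v S) + 3 * int \<delta> - 1 + int (card D)
      \<le> potential S + int (card (live (insert v S) - live S))"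
    using potential_insert_active[OF v X D] unfolding cardX by simp
qed

lemma dominator_boundedI:
  assumes "S \<noteq> {}" "S \<subseteq> verts G"
    and IH: "\<And>T. S \<subset> T \<Longrightarrow> T \<subseteq> verts G \<Longrightarrow> dominator_bounded T \<and> staller_bounded T"
  shows "dominator_bounded S"
proof -
  have S': "S \<subset> insert v S" "insert v S \<subseteq> verts G" if "v \<in> playable S" for v
    using playable_fresh[OF that] assms(2) by auto
  have good: ?thesis if "has_good_move S"
    using that IH S' by (intro dominator_bounded_if_good_move) auto
  show ?thesis
  proof (cases "active S = {}")
    case True
    have "(3 * int \<delta> - 2) * int (remaining_moves Dominator S) \<le> (3 * int \<delta> - 2) * int (card (pending S))"
      using remaining_moves_no_active[OF True] two_le_delta by (intro mult_left_mono) auto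
    then show ?thesis
      by (simp add: dominator_bounded_def potential_def True)
  next
    case active: False
    show ?thesis
    proof (cases "sparse S \<and> (\<forall>x\<in>active S. card (nbrs x \<inter> active S) \<noteq> 1)")
      case False
      then show ?thesis
        using good good_move_if_not_sparse good_move_leaf by (metis card_1_singletonE)
    next
      case True
      then have sp: "sparse S" by blast
      have two: "card (nbrs y \<inter> active S) = 2" if "y \<in> active S" for y
      proof -
        have "card (nbrs y \<inter> active S) \<noteq> 0"
          using active_nbrE[OF that] by auto
        moreover have "card (nbrs y \<inter> active S) \<le> 2" "card (nbrs y \<inter> active S) \<noteq> 1"
          using True that by (auto simp: sparse_def)
        ultimately show ?thesis by linarith
      qed
      \<comment> \<open>Choosing \<open>v\<close> next to a live vertex makes \<open>D\<close>
        nonempty, which matters for \<delta> = 2, where the bound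
        \<open>3 * int \<delta> - 6\<close> is 0.\<close>
      obtain w where w: "w \<in> live S"
        using exists_live active assms(1,2) by blast
      then obtain v where v: "v \<in> nbrs w" "v \<in> active S" "w \<in> neighborhood S"
        by (rule live_nbrE)
      obtain a b where ab: "nbrs v \<inter> active S = {a, b}" "a \<noteq> b"
        using two[OF v(2)] by (auto simp: card_2_iff)
      let ?S' = "insert v S"
      let ?N = "live ?S' - live S"
      obtain D where D: "nbrs v - active S \<subseteq> D" "D \<subseteq> live S" "3 * int \<delta> - 6 \<le> int (card D)"
        "potential ?S' + 3 * int \<delta> - 1 + int (card D) \<le> potential S + int (card ?N)"
        using no_leaf_move[OF sp _ v(2) ab] two by blast
      have vp: "v \<in> playable S"
        using v(2) by (rule playable_active)
      have N2: "card ?N \<le> 2"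
        using card_newly_live[of v S] ab by simp
      have "w \<in> D"
        using D(1) v(1,3) active_not_covered nbrs_sym by blast
      then have D1: "1 \<le> card D"
        using finite_subset[OF D(2)] by (auto simp: Suc_le_eq card_gt_0_iff)
      show ?thesis
      proof (cases "\<delta> \<noteq> 2 \<or> card ?N \<le> card D")
        case True
        then have "int \<delta> - 2 + int (card ?N) \<le> int (card D)"
          using D(3) D1 N2 two_le_delta by linarith
        then have "has_good_move S"
          unfolding has_good_move_def using D(4) vp by (intro bexI[of _ v]) auto
        then show ?thesis by (rule good)
      next
        case False
        \<comment> \<open>Here two vertices become live and only one is known to stop being live, so
          the guaranteed drop is 4 instead of 5. The two new live vertices are the neighbours
          \<open>a\<close> and \<open>b\<close> of the pending vertex \<open>v\<close>, so Staller's
          position needs no surplus.\<close>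
        then have d2: "\<delta> = 2" and "card ?N = 2"
          using N2 D1 by auto
        then have "?N = {a, b}"
          using newly_live[of v S] unfolding ab(1) using ab(2)
          by (intro card_subset_eq) auto
        then have "a \<in> nbrs v \<inter> live ?S'" "b \<in> nbrs v \<inter> live ?S'"
          using ab(1) by blast+
        moreover have "v \<in> pending ?S'"
          using pending_insert_active[OF v(2)] by simp
        moreover have "card (nbrs u \<inter> active ?S') \<le> 1" if u: "u \<in> live ?S'" for u
        proof (cases "u \<in> live S")
          case True
          then have "card (nbrs u \<inter> active S) \<le> 1"
            using sp by (auto simp: sparse_def)
          moreover have "card (nbrs u \<inter> active ?S') \<le> card (nbrs u \<inter> active S)"
            using active_insert_subset by (intro card_mono) auto
          ultimately show ?thesis by linarith
        next
          case False
          \<comment> \<open>A newly live vertex had exactly two active neighbours, and one of them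
            was \<open>v\<close>.\<close>
          then have uv: "u \<in> nbrs v \<inter> active S"
            using u newly_live by blast
          have "card (nbrs u \<inter> active ?S') < card (nbrs u \<inter> active S)"
          proof (rule psubset_card_mono)
            show "nbrs u \<inter> active ?S' \<subset> nbrs u \<inter> active S"
              using active_insert_subset[of v S] uv v(2) nbrs_sym not_active_if_played[of v ?S'] by blast
          qed simp
          then show ?thesis
            using two uv by simp
        qed
        ultimately have "4 * int (remaining_moves Staller ?S') \<le> potential ?S'"
          using S'[OF vp] IH ab(2) d2 by (intro staller_two_live_nbrs[of ?S' v a b]) auto
        moreover have "remaining_moves Dominator S \<le> Suc (remaining_moves Staller ?S')"
          using vp by (rule remaining_moves_Dominator_le)
        moreover have "potential ?S' + 4 \<le> potential S"
          using D(4) D1 d2 \<open>card ?N = 2\<close> by linarith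
        ultimately have "4 * int (remaining_moves Dominator S) \<le> potential S"
          by linarith
        then show ?thesis
          unfolding dominator_bounded_def by (simp add: d2)
      qed
    qed
  qed
qed

section \<open>The induction and the opening move\<close>

text \<open>Induction on the number of unplayed vertices. The empty position is excluded because
  nothing is dominated there, so no vertex is live.\<close>

lemma bounded:
  assumes "S \<noteq> {}" "S \<subseteq> verts G"
  shows "dominator_bounded S \<and> staller_bounded S"
  using assms
proof (induction "card (verts G - S)" arbitrary: S rule: less_induct)
  case less
  have IH: "dominator_bounded T \<and> staller_bounded T" if "S \<subset> T" "T \<subseteq> verts G" for T
  proof (rule less.hyps)
    show "card (verts G - T) < card (verts G - S)"
      using that by (intro psubset_card_mono) auto
  qed (use that in auto)
  show ?case
    using dominator_boundedI staller_boundedI IH less.prems by blast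
qed

text \<open>The first vertex is pending. If active vertices remain, connectivity gives it a live
  neighbour, so Dominator gains \<delta>, which cancels the weight of up to \<delta> live
  neighbours. Each further neighbour adds at most 1 as a live vertex but takes
  \<open>2 * int \<delta> - 1\<close> away from the bound on the active weight.\<close>

lemma dominator_after_first_move:
  assumes x: "x \<in> verts G"
  shows "(3 * int \<delta> - 2) * int (remaining_moves Dominator {x})
    \<le> (2 * int \<delta> - 1) * (int (card (verts G)) - 1 - int \<delta>) + (3 * int \<delta> - 2)"
proof -
  have nb: "neighborhood {x} = nbrs x"
    by (simp add: neighborhood_eq_nbrs)
  have pend: "pending {x} = {x}"
    using x nbrs_irrefl by (auto simp: pending_def uncovered_def nb)
  have d: "\<delta> \<le> card (nbrs x)"
    using x by (rule delta_le_card_nbrs)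
  have "active {x} \<subseteq> verts G - insert x (nbrs x)"
    using not_active_if_played[of x "{x}"] by (auto simp: active_def uncovered_def nb)
  then have "card (active {x}) \<le> card (verts G - insert x (nbrs x))"
    by (intro card_mono) auto
  moreover have "card (verts G - insert x (nbrs x)) + Suc (card (nbrs x)) = card (verts G)"
    using x nbrs_subset_verts[of x] nbrs_irrefl card_Diff_subset[of "insert x (nbrs x)" "verts G"]
      card_mono[of "verts G" "insert x (nbrs x)"] by simp
  ultimately have act: "int (card (active {x})) \<le> int (card (verts G)) - 1 - int (card (nbrs x))"
    by linarith
  have n: "0 \<le> int (card (verts G)) - 1 - int \<delta>"
    using act d by linarith
  show ?thesis
  proof (cases "active {x} = {}")
    case True
    then have "remaining_moves Dominator {x} \<le> 1"
      using remaining_moves_no_active[of "{x}" Dominator] by (simp add: pend)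
    then have "(3 * int \<delta> - 2) * int (remaining_moves Dominator {x}) \<le> (3 * int \<delta> - 2) * 1"
      using two_le_delta by (intro mult_left_mono) auto
    moreover have "0 \<le> (2 * int \<delta> - 1) * (int (card (verts G)) - 1 - int \<delta>)"
      using n two_le_delta by (intro mult_nonneg_nonneg) auto
    ultimately show ?thesis
      by (simp only: mult_1_right add_increasing)
  next
    case False
    then obtain w where w: "w \<in> live {x}"
      using exists_live[of "{x}"] x by blast
    then have wx: "w \<in> nbrs x"
      by (simp add: live_def nb)
    have "(3 * int \<delta> - 2) * int (remaining_moves Dominator {x}) \<le> potential {x} - int \<delta>"
      using dominator_bounded_pending[of x "{x}" w] wx w pend bounded[of "insert w {x}"] x
        nbrs_subset_verts by fast
    moreover have "card (live {x}) \<le> card (nbrs x)"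
      by (intro card_mono) (auto simp: live_def nb)
    moreover have "(2 * int \<delta> - 1) * int (card (active {x}))
        \<le> (2 * int \<delta> - 1) * (int (card (verts G)) - 1 - int (card (nbrs x)))"
      using act two_le_delta by (intro mult_left_mono) auto
    moreover have "(2 * int \<delta> - 2) * int \<delta> \<le> (2 * int \<delta> - 2) * int (card (nbrs x))"
      using d two_le_delta by (intro mult_left_mono) auto
    ultimately show ?thesis
      by (simp add: potential_def pend algebra_simps)
  qed
qed

lemma game_total_isolation_number_le:
  "(3 * int \<delta> - 2) * int staller_start_game_total_isolation_number
    \<le> (2 * int \<delta> - 1) * int (card (verts G)) - (int \<delta> - 1) * (2 * int \<delta> - 3)"
proof -
  let ?bound = "(2 * int \<delta> - 1) * (int (card (verts G)) - 1 - int \<delta>) + (3 * int \<delta> - 2)"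
  have "(3 * int \<delta> - 2) * int (remaining_moves Staller {}) \<le> ?bound + (3 * int \<delta> - 2)"
  proof (rule remaining_moves_StallerE[of "{}"])
    assume zero: "remaining_moves Staller {} = 0"
    obtain x where "x \<in> verts G"
      using connected_graph by (auto simp: connected_conv)
    \<comment> \<open>The bound dominates a nonnegative multiple of a number of moves, whichever
      vertex is taken as the first move.\<close>
    then have "0 \<le> ?bound"
      using dominator_after_first_move[of x] two_le_delta
      by (intro order_trans[OF _ dominator_after_first_move[of x]] mult_nonneg_nonneg) auto
    then show ?thesis
      using zero two_le_delta by simp
  next
    fix x assume x: "x \<in> playable {}"
      and "remaining_moves Staller {} = Suc (remaining_moves Dominator {x})"
    then show ?thesis
      using dominator_after_first_move[of x] playable_fresh[OF x] by (simp add: algebra_simps)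
  qed
  then show ?thesis
    unfolding staller_start_game_total_isolation_number_def by (simp add: algebra_simps)
qed

end

theorem theorem3p3:
  fixes G :: "('a, 'b) pre_digraph" and n \<delta> :: nat
  assumes "graph G"
    and "Digraph_Component.connected G"
    and "n = card (verts G)" and "n \<ge> 3"
    and "\<delta> = min_degree G" and "\<delta> \<ge> 2"
  shows "real (graph.staller_start_game_total_isolation_number G)
    \<le> ((2 * real \<delta> - 1) / (3 * real \<delta> - 2)) * real n
      - ((real \<delta> - 1) * (2 * real \<delta> - 3)) / (3 * real \<delta> - 2)"
proof -
  interpret graph G by fact
  interpret min_degree_graph G \<delta>
  proof
    show "\<delta> \<le> card (nbrs v)" if "v \<in> verts G" for v
      using that by (simp add: assms(5) min_degree_def flip: out_degree_eq_card_nbrs)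
  qed (use assms in auto)
  have "real_of_int ((3 * int \<delta> - 2) * int staller_start_game_total_isolation_number)
      \<le> real_of_int ((2 * int \<delta> - 1) * int n - (int \<delta> - 1) * (2 * int \<delta> - 3))"
    using game_total_isolation_number_le by (simp only: of_int_le_iff assms(3))
  then have "(3 * real \<delta> - 2) * real staller_start_game_total_isolation_number
      \<le> (2 * real \<delta> - 1) * real n - (real \<delta> - 1) * (2 * real \<delta> - 3)"
    by simp
  moreover have "0 < 3 * real \<delta> - 2"
    using assms(6) by simp
  ultimately show ?thesis
    unfolding times_divide_eq_left diff_divide_distrib[symmetric]
    by (subst pos_le_divide_eq) (simp_all only: mult.commute)
qed

end
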